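(* Let $G$ denote the cyclic group of order $n \geq 2$. Let $\operatorname{SL}(\mathbb{C}G)$ be the set of all complex $n \times n$ circulant matrices $$\begin{pmatrix} a_{0} & a_{n - 1} & \cdots & a_{1} \\ a_{1} & a_{0} & \cdots & a_{2} \\ \vdots & \vdots & \ddots & \vdots \\ a_{n - 1} & a_{n - 2} & \cdots & a_{0} \end{pmatrix}, \qquad a_0, a_1, \ldots, a_{n-1} \in \mathbb{C},$$ that belong to $\operatorname{SL}(n,\mathbb{C})$, and let $$\mathbb{C}[\mathbf{x}]^{\operatorname{SL}(\mathbb{C}G)} := \{ f(\mathbf{x}) \in \mathbb{C}[\mathbf{x}] \mid f(A\mathbf{x}) = f(\mathbf{x}) \text{ for any } A \in \operatorname{SL}(\mathbb{C}G) \}.$$ Then $$\mathbb{C}[\mathbf{x}]^{\operatorname{SL}(\mathbb{C}G)} = \mathbb{C}[\Theta_{n}(\mathbf{x})] \subset \mathbb{C}[\mathbf{x}]^{D}.$$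
   Context: $\mathbf{x} = {}^t(x_0, \ldots, x_{n-1})$ is a column vector of variables and $\mathbb{C}[\mathbf{x}] = \mathbb{C}[x_0,\ldots,x_{n-1}]$. With the convention $x_{-1} := x_{n-1}$, $D := \sum_{i=0}^{n-1} x_{i-1}\frac{\partial}{\partial x_i}$ and $\mathbb{C}[\mathbf{x}]^{D} := \{f \in \mathbb{C}[\mathbf{x}] \mid Df = 0\}$. $\Theta_n(\mathbf{x})$ denotes the circulant determinant of order $n$, i.e. the determinant of the $n\times n$ matrix whose $(r,s)$ entry ($0 \le r,s \le n-1$) is $x_{(r-s) \bmod n}$; $\mathbb{C}[\Theta_n(\mathbf{x})]$ is the $\mathbb{C}$-subalgebra of $\mathbb{C}[\mathbf{x}]$ generated by it. The symbol $\subset$ means inclusion, not necessarily strict. *)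

theory Defs
  imports "HOL-Library.Poly_Mapping" "Jordan_Normal_Form.Determinant"
begin

text \<open>Complex polynomials in variables indexed by \<open>nat\<close>: finitely supported maps from monomials
  (finitely supported exponent functions) to coefficients. The ring structure, with convolution
  as multiplication, comes from \<^theory>\<open>HOL-Library.Poly_Mapping\<close>.\<close>

type_synonym cpoly = "(nat \<Rightarrow>\<^sub>0 nat) \<Rightarrow>\<^sub>0 complex"

definition Const :: "complex \<Rightarrow> cpoly" where
  "Const c = Poly_Mapping.single 0 c"

definition Var :: "nat \<Rightarrow> cpoly" where
  "Var i = Poly_Mapping.single (Poly_Mapping.single i 1) 1"

text \<open>The polynomial ring $\mathbb{C}[x_0,\ldots,x_{n-1}]$.\<close>

definition poly_ring :: "nat \<Rightarrow> cpoly set" where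
  "poly_ring n = {f. \<forall>m \<in> Poly_Mapping.keys f. Poly_Mapping.keys m \<subseteq> {..<n}}"

definition subst_poly :: "(nat \<Rightarrow> cpoly) \<Rightarrow> cpoly \<Rightarrow> cpoly" where
  "subst_poly \<sigma> f = (\<Sum>m \<in> Poly_Mapping.keys f. Const (Poly_Mapping.lookup f m) *
     (\<Prod>i \<in> Poly_Mapping.keys m. \<sigma> i ^ Poly_Mapping.lookup m i))"

text \<open>If the exponent of \<open>x\<^sub>i\<close> in \<open>m\<close> is zero, the truncated exponent subtraction below is
  harmless because the coefficient vanishes.\<close>

definition partial_deriv :: "nat \<Rightarrow> cpoly \<Rightarrow> cpoly" where
  "partial_deriv i f = (\<Sum>m \<in> Poly_Mapping.keys f.
     Poly_Mapping.single (m - Poly_Mapping.single i 1)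
       (of_nat (Poly_Mapping.lookup m i) * Poly_Mapping.lookup f m))"

definition D_op :: "nat \<Rightarrow> cpoly \<Rightarrow> cpoly" where
  "D_op n f = (\<Sum>i<n. Var (if i = 0 then n - 1 else i - 1) * partial_deriv i f)"

definition D_constants :: "nat \<Rightarrow> cpoly set" where
  "D_constants n = {f \<in> poly_ring n. D_op n f = 0}"

text \<open>For \<open>r, s < n\<close> the index \<open>(r + n - s) mod n\<close> is \<open>r - s\<close> modulo \<open>n\<close>; adding \<open>n\<close> first avoids
  truncated subtraction.\<close>

definition circulant_mat :: "nat \<Rightarrow> (nat \<Rightarrow> 'a) \<Rightarrow> 'a mat" where
  "circulant_mat n a = mat n n (\<lambda>(r, s). a ((r + n - s) mod n))"

definition circulant_det :: "nat \<Rightarrow> cpoly" where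
  "circulant_det n = det (circulant_mat n Var)"

definition SL :: "nat \<Rightarrow> complex mat set" where
  "SL n = {A \<in> carrier_mat n n. det A = 1}"

definition SL_circulant :: "nat \<Rightarrow> complex mat set" where
  "SL_circulant n = {circulant_mat n a | a. True} \<inter> SL n"

text \<open>The polynomial \<open>f(A x)\<close>, where \<open>x\<close> is the column vector of the variables.\<close>

definition act :: "nat \<Rightarrow> complex mat \<Rightarrow> cpoly \<Rightarrow> cpoly" where
  "act n A f = subst_poly (\<lambda>i. (map_mat Const A *\<^sub>v vec n Var) $ i) f"

definition invariants :: "nat \<Rightarrow> complex mat set \<Rightarrow> cpoly set" where
  "invariants n H = {f \<in> poly_ring n. \<forall>A \<in> H. act n A f = f}"

definition is_subalgebra :: "cpoly set \<Rightarrow> bool" where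
  "is_subalgebra S \<longleftrightarrow> range Const \<subseteq> S \<and>
     (\<forall>f \<in> S. \<forall>g \<in> S. f + g \<in> S) \<and> (\<forall>f \<in> S. \<forall>g \<in> S. f * g \<in> S)"

text \<open>The subalgebra of \<open>poly_ring n\<close> generated by \<open>T\<close>, for \<open>T \<subseteq> poly_ring n\<close>.\<close>

definition generated_subalgebra :: "nat \<Rightarrow> cpoly set \<Rightarrow> cpoly set" where
  "generated_subalgebra n T = (\<lambda>S. S \<subseteq> poly_ring n \<and> is_subalgebra S) hull T"

end

theory Submission
  imports Defs
begin

text \<open>The idea is to diagonalise. Let \<open>w = exp (2 \<pi> i / n)\<close> and pass from the variables \<open>x\<^sub>j\<close> to
  their Fourier transforms \<open>y\<^sub>k = (\<Sum>j<n. w^(j k) x\<^sub>j)\<close>, an invertible linear change of coordinates.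
  Applying a circulant matrix to the variables is cyclic convolution with its first column \<open>a\<close>, so
  in the new coordinates it multiplies each \<open>y\<^sub>k\<close> by the Fourier coefficient \<open>t\<^sub>k\<close> of \<open>a\<close>
  (\<open>dft_cyclic_conv\<close>). Its determinant is the product of the \<open>t\<^sub>k\<close> (\<open>det_circulant_mat\<close>), which over
  the polynomial ring says that the circulant determinant is the product of the \<open>y\<^sub>k\<close>. As Fourier
  inversion lets the \<open>t\<^sub>k\<close> be prescribed freely, the unimodular circulant matrices become the whole
  torus of diagonal matrices with \<open>\<Prod>t\<^sub>k = 1\<close>.

  The torus scales a monomial in the \<open>y\<^sub>k\<close> with exponents \<open>m\<^sub>k\<close> by \<open>\<Prod>t\<^sub>k^m\<^sub>k\<close>. A polynomial is therefore
  invariant only if all its monomials have equal exponents (\<open>torus_invariant_exponents_equal\<close>),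
  which makes it a polynomial in \<open>\<Prod>y\<^sub>k\<close> (\<open>invariant_in_subalgebra\<close>). Conversely \<open>\<Prod>y\<^sub>k\<close> is scaled
  by \<open>\<Prod>t\<^sub>k = 1\<close>.

  The derivation \<open>D\<close> shifts the variables cyclically, hence \<open>D y\<^sub>k = w^k y\<^sub>k\<close> and, by the Leibniz rule,
  \<open>D (\<Prod>y\<^sub>k) = (\<Sum>k<n. w^k) (\<Prod>y\<^sub>k)\<close>. The sum of the \<open>n\<close>-th roots of unity vanishes for \<open>n \<ge> 2\<close>, and
  the kernel of a derivation is a subalgebra.\<close>

section \<open>The discrete Fourier transform at a principal root of unity\<close>

definition dft :: "nat \<Rightarrow> 'a::comm_ring_1 \<Rightarrow> (nat \<Rightarrow> 'a) \<Rightarrow> nat \<Rightarrow> 'a" where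
  "dft n w x k = (\<Sum>j<n. w ^ (j * k) * x j)"

text \<open>The intended arguments are \<open>v = 1 / w\<close> and \<open>c = 1 / n\<close>. They are passed explicitly because the
  transform is also taken over the polynomial ring, which has no division.\<close>

definition inv_dft :: "nat \<Rightarrow> 'a::comm_ring_1 \<Rightarrow> 'a \<Rightarrow> (nat \<Rightarrow> 'a) \<Rightarrow> nat \<Rightarrow> 'a" where
  "inv_dft n v c y j = c * (\<Sum>k<n. v ^ (j * k) * y k)"

definition cyclic_conv :: "nat \<Rightarrow> (nat \<Rightarrow> 'a::comm_ring_1) \<Rightarrow> (nat \<Rightarrow> 'a) \<Rightarrow> nat \<Rightarrow> 'a" where
  "cyclic_conv n a x r = (\<Sum>s<n. a ((r + n - s) mod n) * x s)"

text \<open>Group laws for residues, with \<open>r - s\<close> encoded as \<open>(r + n - s) mod n\<close>. They make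
  \<open>r \<mapsto> r - s\<close> and \<open>s \<mapsto> r - s\<close> bijections, along which sums over residues are reindexed.\<close>

lemma sub_mod_add_cancel:
  fixes n r s :: nat
  assumes "r < n" "s < n"
  shows "((r + n - s) mod n + s) mod n = r"
proof -
  have "((r + n - s) mod n + s) mod n = (r + n - s + s) mod n"
    by (simp add: mod_add_left_eq)
  also have "\<dots> = r"
    using assms by simp
  finally show ?thesis .
qed

lemma add_mod_sub_cancel:
  fixes n d s :: nat
  assumes "d < n" "s < n"
  shows "((d + s) mod n + n - s) mod n = d"
proof (cases "d + s < n")
  case True
  then show ?thesis using assms by simp
next
  case False
  then have "(d + s) mod n = d + s - n"
    using assms by (simp add: mod_if)
  then show ?thesis using assms False by simp
qed

lemma sub_mod_involutive:
  fixes n r s :: nat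
  assumes "r < n" "s < n"
  shows "(r + n - (r + n - s) mod n) mod n = s"
proof (cases "s \<le> r")
  case True
  then have "(r + n - s) mod n = r - s"
    using assms by (metis Nat.add_diff_assoc2 less_imp_diff_less mod_add_self2 mod_less)
  then show ?thesis using assms True by simp
next
  case False
  then have "(r + n - s) mod n = r + n - s"
    using assms by simp
  then show ?thesis using assms False by simp
qed

lemma sum_cyclic_shift:
  fixes n s :: nat
  assumes "s < n"
  shows "(\<Sum>r<n. h ((r + n - s) mod n)) = (\<Sum>d<n. h d)"
  using assms
  by (intro sum.reindex_bij_witness[of _ "\<lambda>d. (d + s) mod n" "\<lambda>r. (r + n - s) mod n"])
    (auto simp: sub_mod_add_cancel add_mod_sub_cancel)

lemma sum_cyclic_reflect:
  fixes n r :: nat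
  assumes "r < n"
  shows "(\<Sum>s<n. h ((r + n - s) mod n)) = (\<Sum>d<n. h d)"
  using assms
  by (intro sum.reindex_bij_witness[of _ "\<lambda>d. (r + n - d) mod n" "\<lambda>s. (r + n - s) mod n"])
    (auto simp: sub_mod_involutive)

text \<open>In a ring with zero divisors a primitive root of unity need not satisfy the orthogonality
  relations; the vanishing power sums of a principal root are what Fourier inversion uses. This
  generality lets the same results serve both complex numbers, for the entries of a matrix, and
  polynomials, for its action on the variables.\<close>

locale principal_root =
  fixes n :: nat and w v c :: "'a::comm_ring_1"
  assumes n_pos: "n > 0"
    and root: "w ^ n = 1"
    and sum_powers: "\<And>d. 0 < d \<Longrightarrow> d < n \<Longrightarrow> (\<Sum>k<n. w ^ (d * k)) = 0"
    and root_inverse: "v * w = 1"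
    and n_inverse: "of_nat n * c = 1"
begin

lemma power_eq_if_mod_eq:
  assumes "a mod n = b mod n"
  shows "w ^ a = w ^ b"
proof -
  have "w ^ e = w ^ (e mod n)" for e
  proof -
    have "w ^ e = w ^ (n * (e div n) + e mod n)" by simp
    also have "\<dots> = w ^ (e mod n)" by (simp only: power_add power_mult root) simp
    finally show ?thesis .
  qed
  then show ?thesis using assms by metis
qed

lemma inverse_root_power: "v ^ e * w ^ e = 1"
  by (simp add: root_inverse flip: power_mult_distrib)

lemma orthogonality:
  assumes "i < n" "j < n"
  shows "(\<Sum>k<n. v ^ (i * k) * w ^ (j * k)) = (if i = j then of_nat n else 0)"
proof -
  let ?d = "(j + n - i) mod n"
  have d: "(?d + i) mod n = j"
    using sub_mod_add_cancel[of j n i] assms by simp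
  have "v ^ (i * k) * w ^ (j * k) = w ^ (?d * k)" for k
  proof -
    have "w ^ (j * k) = w ^ ((?d + i) * k)"
      by (rule power_eq_if_mod_eq) (metis d mod_mult_left_eq)
    also have "\<dots> = w ^ (i * k) * w ^ (?d * k)"
      by (simp add: power_add algebra_simps)
    finally show ?thesis
      using inverse_root_power[of "i * k"] by (simp add: mult.assoc[symmetric])
  qed
  then have "(\<Sum>k<n. v ^ (i * k) * w ^ (j * k)) = (\<Sum>k<n. w ^ (?d * k))"
    by simp
  also have "\<dots> = (if i = j then of_nat n else 0)"
  proof (cases "i = j")
    case True
    then show ?thesis by simp
  next
    case False
    then have "?d \<noteq> 0" using d assms by (metis add_0 mod_less)
    then show ?thesis using False sum_powers[of ?d] n_pos by simp
  qed
  finally show ?thesis .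
qed

lemma inv_dft_dft:
  assumes "i < n"
  shows "inv_dft n v c (dft n w x) i = x i"
proof -
  have "inv_dft n v c (dft n w x) i =
      c * (\<Sum>k<n. \<Sum>j<n. v ^ (i * k) * w ^ (j * k) * x j)"
    by (simp add: inv_dft_def dft_def sum_distrib_left mult.assoc)
  also have "\<dots> = c * (\<Sum>j<n. (\<Sum>k<n. v ^ (i * k) * w ^ (j * k)) * x j)"
    by (subst sum.swap) (simp add: sum_distrib_right)
  also have "\<dots> = c * (\<Sum>j<n. (if i = j then of_nat n else 0) * x j)"
    using assms by (simp add: orthogonality)
  also have "\<dots> = c * (\<Sum>j<n. if i = j then of_nat n * x j else 0)"
    by (intro arg_cong[where f = "\<lambda>t. c * t"] sum.cong) auto
  also have "\<dots> = of_nat n * c * x i"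
    using assms by (simp add: ac_simps)
  finally show ?thesis by (simp add: n_inverse)
qed

lemma dft_inv_dft:
  assumes "i < n"
  shows "dft n w (inv_dft n v c y) i = y i"
proof -
  have "dft n w (inv_dft n v c y) i =
      c * (\<Sum>j<n. \<Sum>k<n. v ^ (k * j) * w ^ (i * j) * y k)"
    by (simp add: inv_dft_def dft_def sum_distrib_left ac_simps)
  also have "\<dots> = c * (\<Sum>k<n. (\<Sum>j<n. v ^ (k * j) * w ^ (i * j)) * y k)"
    by (subst sum.swap) (simp add: sum_distrib_right)
  also have "\<dots> = c * (\<Sum>k<n. (if k = i then of_nat n else 0) * y k)"
    using assms by (simp add: orthogonality)
  also have "\<dots> = c * (\<Sum>k<n. if k = i then of_nat n * y k else 0)"
    by (intro arg_cong[where f = "\<lambda>t. c * t"] sum.cong) auto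
  also have "\<dots> = of_nat n * c * y i"
    using assms by (simp add: ac_simps)
  finally show ?thesis by (simp add: n_inverse)
qed

text \<open>The characters of the cyclic group are common eigenvectors of all circulant matrices, since
  \<open>v^(s k) = v^(r k) w^((r - s) k)\<close>. The eigenvalues are the Fourier coefficients.\<close>

lemma cyclic_conv_character:
  assumes "r < n"
  shows "cyclic_conv n a (\<lambda>s. v ^ (s * k)) r = v ^ (r * k) * dft n w a k"
proof -
  have "a ((r + n - s) mod n) * v ^ (s * k) =
      v ^ (r * k) * (w ^ ((r + n - s) mod n * k) * a ((r + n - s) mod n))" if "s < n" for s
  proof -
    let ?d = "(r + n - s) mod n"
    have "w ^ (r * k) = w ^ ((?d + s) * k)"
      by (rule power_eq_if_mod_eq) (metis sub_mod_add_cancel[OF assms that] mod_mult_left_eq)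
    then have split: "w ^ (r * k) = w ^ (?d * k) * w ^ (s * k)"
      by (simp add: power_add algebra_simps)
    have "v ^ (r * k) * w ^ (?d * k) = v ^ (r * k) * w ^ (?d * k) * (v ^ (s * k) * w ^ (s * k))"
      by (simp add: inverse_root_power)
    also have "\<dots> = v ^ (s * k) * (v ^ (r * k) * (w ^ (?d * k) * w ^ (s * k)))"
      by (simp only: ac_simps)
    also have "\<dots> = v ^ (s * k)"
      by (simp only: split[symmetric] inverse_root_power) simp
    finally have "v ^ (s * k) = v ^ (r * k) * w ^ (?d * k)" ..
    then show ?thesis by (simp only: ac_simps)
  qed
  then have "cyclic_conv n a (\<lambda>s. v ^ (s * k)) r =
      v ^ (r * k) * (\<Sum>s<n. w ^ ((r + n - s) mod n * k) * a ((r + n - s) mod n))"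
    by (simp add: cyclic_conv_def sum_distrib_left)
  also have "(\<Sum>s<n. w ^ ((r + n - s) mod n * k) * a ((r + n - s) mod n)) = dft n w a k"
    unfolding dft_def using sum_cyclic_reflect[OF assms, of "\<lambda>d. w ^ (d * k) * a d"] .
  finally show ?thesis .
qed

lemma cyclic_conv_inv_dft:
  assumes "r < n"
  shows "cyclic_conv n a (inv_dft n v c y) r = inv_dft n v c (\<lambda>k. dft n w a k * y k) r"
proof -
  have "cyclic_conv n a (inv_dft n v c y) r =
      (\<Sum>s<n. \<Sum>k<n. c * (a ((r + n - s) mod n) * v ^ (s * k) * y k))"
    by (simp add: cyclic_conv_def inv_dft_def sum_distrib_left ac_simps)
  also have "\<dots> = c * (\<Sum>k<n. cyclic_conv n a (\<lambda>s. v ^ (s * k)) r * y k)"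
    by (subst sum.swap) (simp add: cyclic_conv_def sum_distrib_left sum_distrib_right)
  also have "\<dots> = inv_dft n v c (\<lambda>k. dft n w a k * y k) r"
    by (simp add: cyclic_conv_character[OF assms] inv_dft_def mult.assoc)
  finally show ?thesis .
qed

lemma dft_cyclic_conv:
  assumes "k < n"
  shows "dft n w (cyclic_conv n a x) k = dft n w a k * dft n w x k"
proof -
  have "cyclic_conv n a x r = inv_dft n v c (\<lambda>k. dft n w a k * dft n w x k) r" if "r < n" for r
  proof -
    have "cyclic_conv n a x r = cyclic_conv n a (inv_dft n v c (dft n w x)) r"
      by (simp add: cyclic_conv_def inv_dft_dft)
    then show ?thesis by (simp add: cyclic_conv_inv_dft[OF that])
  qed
  then have "dft n w (cyclic_conv n a x) k =
      dft n w (inv_dft n v c (\<lambda>k. dft n w a k * dft n w x k)) k"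
    by (simp add: dft_def)
  then show ?thesis by (simp add: dft_inv_dft[OF assms])
qed

text \<open>The matrix of characters conjugates the circulant matrix to a diagonal one. Cancelling its
  determinant is legitimate because Fourier inversion makes it a unit.\<close>

lemma det_circulant_mat: "det (circulant_mat n a) = (\<Prod>k<n. dft n w a k)"
proof -
  define V where "V = mat n n (\<lambda>(s, k). v ^ (s * k))"
  define W where "W = mat n n (\<lambda>(k, s). c * w ^ (k * s))"
  have carrier: "V \<in> carrier_mat n n" "W \<in> carrier_mat n n" "circulant_mat n a \<in> carrier_mat n n"
    by (auto simp: V_def W_def circulant_mat_def)
  have "V * W = 1\<^sub>m n"
  proof (rule eq_matI)
    fix i j assume ij: "i < dim_row (1\<^sub>m n :: 'a mat)" "j < dim_col (1\<^sub>m n :: 'a mat)"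
    then have "(V * W) $$ (i, j) = (\<Sum>k<n. v ^ (i * k) * (c * w ^ (k * j)))"
      by (simp add: V_def W_def scalar_prod_def atLeast0LessThan)
    also have "\<dots> = c * (\<Sum>k<n. v ^ (i * k) * w ^ (j * k))"
      by (simp add: sum_distrib_left ac_simps)
    finally show "(V * W) $$ (i, j) = 1\<^sub>m n $$ (i, j)"
      using ij n_inverse by (simp add: orthogonality mult.commute[of c])
  qed (auto simp: V_def W_def)
  then have VW: "det V * det W = 1"
    using det_mult[OF carrier(1,2)] by simp
  have "circulant_mat n a * V = V * mat_diag n (dft n w a)"
  proof (rule eq_matI)
    fix r k assume "r < dim_row (V * mat_diag n (dft n w a))" "k < dim_col (V * mat_diag n (dft n w a))"
    then have rk: "r < n" "k < n" by (auto simp: V_def mat_diag_def)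
    then have "(circulant_mat n a * V) $$ (r, k) = cyclic_conv n a (\<lambda>s. v ^ (s * k)) r"
      by (simp add: circulant_mat_def V_def scalar_prod_def cyclic_conv_def atLeast0LessThan)
    also have "\<dots> = (V * mat_diag n (dft n w a)) $$ (r, k)"
      using rk by (simp add: cyclic_conv_character mat_diag_mult_right[OF carrier(1)])
        (simp add: V_def)
    finally show "(circulant_mat n a * V) $$ (r, k) = (V * mat_diag n (dft n w a)) $$ (r, k)" .
  qed (auto simp: circulant_mat_def V_def mat_diag_def)
  then have CV: "det (circulant_mat n a) * det V = det V * det (mat_diag n (dft n w a))"
    using carrier by (metis det_mult mat_diag_dim)
  have "det (circulant_mat n a) = det (circulant_mat n a) * det V * det W"
    by (simp add: VW mult.assoc)
  also have "\<dots> = det (mat_diag n (dft n w a)) * (det V * det W)"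
    by (simp only: CV) (simp only: ac_simps)
  also have "\<dots> = det (mat_diag n (dft n w a))"
    by (simp add: VW)
  also have "\<dots> = (\<Prod>k<n. dft n w a k)"
    by (subst det_upper_triangular[of _ n])
      (auto simp: mat_diag_def diag_mat_def prod.list_conv_set_nth atLeast0LessThan
        intro!: prod.cong)
  finally show ?thesis .
qed

end

lemma principal_root_cis:
  assumes "n > 0"
  shows "principal_root n (cis (2 * pi / n)) (cis (- 2 * pi / n)) (1 / of_nat n)"
proof
  let ?w = "cis (2 * pi / n)"
  have pow: "?w ^ k = cis (2 * pi * k / n)" for k
    by (simp add: DeMoivre mult.commute)
  show root: "?w ^ n = 1" using assms by (simp add: pow)
  fix d assume d: "0 < d" "d < n"
  have "inj_on (\<lambda>k::nat. cis (2 * pi * k / n)) {..<n}"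
    using bij_betw_roots_unity[OF assms] by (simp add: bij_betw_def)
  then have "?w ^ d \<noteq> 1"
    using d assms unfolding pow by (auto dest!: inj_onD[of _ _ d 0])
  moreover have "(?w ^ d) ^ n = 1"
    by (metis root power_mult mult.commute power_one)
  ultimately have "(\<Sum>k<n. (?w ^ d) ^ k) = 0"
    by (simp add: geometric_sum)
  then show "(\<Sum>k<n. ?w ^ (d * k)) = 0" by (simp add: power_mult)
qed (use assms in \<open>auto simp: cis_mult\<close>)

section \<open>Polynomials and substitution\<close>

lemma Const_add: "Const (a + b) = Const a + Const b"
  by (simp add: Const_def single_add)

lemma Const_mult: "Const (a * b) = Const a * Const b"
  by (simp add: Const_def mult_single)

lemma Const_0 [simp]: "Const 0 = 0" and Const_1 [simp]: "Const 1 = 1"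
  by (simp_all add: Const_def)

lemma Const_power: "Const (a ^ k) = Const a ^ k"
  by (induction k) (simp_all add: Const_mult)

lemma Const_sum: "Const (sum h A) = (\<Sum>i\<in>A. Const (h i))"
  by (induction A rule: infinite_finite_induct) (simp_all add: Const_add)

lemma Const_prod: "Const (prod h A) = (\<Prod>i\<in>A. Const (h i))"
  by (induction A rule: infinite_finite_induct) (simp_all add: Const_mult)

lemma Const_of_nat: "Const (of_nat k) = of_nat k"
  by (induction k) (simp_all add: Const_add)

lemma principal_root_Const:
  assumes "principal_root n w v c"
  shows "principal_root n (Const w) (Const v) (Const c)"
proof -
  interpret principal_root n w v c by fact
  show ?thesis
  proof
    show "(\<Sum>k<n. Const w ^ (d * k)) = 0" if "0 < d" "d < n" for d
      using sum_powers[OF that] by (simp flip: Const_power Const_sum)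
  qed (simp_all add: n_pos root root_inverse n_inverse flip: Const_power Const_of_nat Const_mult)
qed

lemma dft_Const: "dft n (Const w) (\<lambda>j. Const (a j)) k = Const (dft n w a k)"
  by (simp add: dft_def Const_sum Const_mult Const_power)

lemma poly_mapping_sum_singles:
  "f = (\<Sum>m\<in>Poly_Mapping.keys f. Poly_Mapping.single m (Poly_Mapping.lookup f m))"
proof (rule poly_mapping_eqI)
  fix m
  have "(\<Sum>l\<in>Poly_Mapping.keys f. Poly_Mapping.lookup (Poly_Mapping.single l (Poly_Mapping.lookup f l)) m)
      = (\<Sum>l\<in>Poly_Mapping.keys f. if l = m then Poly_Mapping.lookup f m else 0)"
    by (intro sum.cong) (auto simp: lookup_single)
  then show "Poly_Mapping.lookup f m = Poly_Mapping.lookup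
      (\<Sum>m\<in>Poly_Mapping.keys f. Poly_Mapping.single m (Poly_Mapping.lookup f m)) m"
    by (auto simp: lookup_sum in_keys_iff)
qed

text \<open>Every polynomial is a sum of terms, so a biadditive expression is determined by its values on
  terms. Multiplicativity of substitution and the Leibniz rule are proved this way.\<close>

lemma biadditive_eqI:
  fixes P Q :: "cpoly \<Rightarrow> cpoly \<Rightarrow> cpoly"
  assumes add: "\<And>f f' g. P (f + f') g = P f g + P f' g" "\<And>f g g'. P f (g + g') = P f g + P f g'"
      "\<And>f f' g. Q (f + f') g = Q f g + Q f' g" "\<And>f g g'. Q f (g + g') = Q f g + Q f g'"
    and single: "\<And>m c m' c'. P (Poly_Mapping.single m c) (Poly_Mapping.single m' c') =
      Q (Poly_Mapping.single m c) (Poly_Mapping.single m' c')"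
  shows "P f g = Q f g"
proof -
  have zero: "R 0 = 0" if "\<And>f g. R (f + g) = R f + R g" for R :: "cpoly \<Rightarrow> cpoly"
    using that[of 0 0] by simp
  have additive_sum: "R (sum h A) = (\<Sum>a\<in>A. R (h a))"
    if "\<And>f g. R (f + g) = R f + R g" for R :: "cpoly \<Rightarrow> cpoly" and h :: "(nat \<Rightarrow>\<^sub>0 nat) \<Rightarrow> cpoly" and A
    by (induction A rule: infinite_finite_induct) (simp_all add: that zero[of R])
  let ?s = "\<lambda>f m. Poly_Mapping.single m (Poly_Mapping.lookup f m)"
  have expand: "R f g = (\<Sum>m\<in>Poly_Mapping.keys f. \<Sum>m'\<in>Poly_Mapping.keys g. R (?s f m) (?s g m'))"
    if "\<And>f f' g. R (f + f') g = R f g + R f' g" "\<And>f g g'. R f (g + g') = R f g + R f g'"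
    for R :: "cpoly \<Rightarrow> cpoly \<Rightarrow> cpoly"
  proof -
    have "R f g = R (\<Sum>m\<in>Poly_Mapping.keys f. ?s f m) (\<Sum>m\<in>Poly_Mapping.keys g. ?s g m)"
      by (simp only: poly_mapping_sum_singles[symmetric])
    also have "\<dots> = (\<Sum>m\<in>Poly_Mapping.keys f. R (?s f m) (\<Sum>m\<in>Poly_Mapping.keys g. ?s g m))"
      by (rule additive_sum[where R = "\<lambda>f. R f _"]) (rule that(1))
    also have "\<dots> = (\<Sum>m\<in>Poly_Mapping.keys f. \<Sum>m'\<in>Poly_Mapping.keys g. R (?s f m) (?s g m'))"
      by (intro sum.cong refl additive_sum) (rule that(2))
    finally show ?thesis .
  qed
  show ?thesis
    unfolding expand[of P, OF add(1,2)] expand[of Q, OF add(3,4)] single ..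
qed

lemma monomial_value_add:
  fixes \<sigma> :: "nat \<Rightarrow> cpoly"
  shows "(\<Prod>i\<in>Poly_Mapping.keys (m + m'). \<sigma> i ^ Poly_Mapping.lookup (m + m') i) =
    (\<Prod>i\<in>Poly_Mapping.keys m. \<sigma> i ^ Poly_Mapping.lookup m i) *
    (\<Prod>i\<in>Poly_Mapping.keys m'. \<sigma> i ^ Poly_Mapping.lookup m' i)"
proof -
  let ?S = "Poly_Mapping.keys m \<union> Poly_Mapping.keys m'"
  have extend: "(\<Prod>i\<in>Poly_Mapping.keys l. \<sigma> i ^ Poly_Mapping.lookup l i) =
      (\<Prod>i\<in>?S. \<sigma> i ^ Poly_Mapping.lookup l i)" if "Poly_Mapping.keys l \<subseteq> ?S" for l
    using that by (intro prod.mono_neutral_left) (auto simp: in_keys_iff)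
  show ?thesis
    unfolding extend[OF keys_add] extend[OF Un_upper1] extend[OF Un_upper2]
    by (simp add: lookup_add power_add prod.distrib)
qed

lemma subst_poly_single:
  "subst_poly \<sigma> (Poly_Mapping.single m c) =
    Const c * (\<Prod>i\<in>Poly_Mapping.keys m. \<sigma> i ^ Poly_Mapping.lookup m i)"
  by (cases "c = 0") (simp_all add: subst_poly_def)

lemma subst_poly_Const [simp]: "subst_poly \<sigma> (Const c) = Const c"
  using subst_poly_single[of \<sigma> 0 c] by (simp add: Const_def)

lemma subst_poly_Var [simp]: "subst_poly \<sigma> (Var i) = \<sigma> i"
  by (simp add: Var_def subst_poly_single)

lemma subst_poly_add: "subst_poly \<sigma> (f + g) = subst_poly \<sigma> f + subst_poly \<sigma> g"
  unfolding subst_poly_def by (rule setsum_keys_plus_distrib) (simp_all add: Const_add distrib_right)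

lemma subst_poly_mult: "subst_poly \<sigma> (f * g) = subst_poly \<sigma> f * subst_poly \<sigma> g"
  by (rule biadditive_eqI[of "\<lambda>f g. subst_poly \<sigma> (f * g)"])
    (simp_all add: subst_poly_add algebra_simps mult_single subst_poly_single Const_mult
      monomial_value_add)

lemma subst_poly_sum: "subst_poly \<sigma> (sum h A) = (\<Sum>i\<in>A. subst_poly \<sigma> (h i))"
  using subst_poly_Const[of \<sigma> 0]
  by (induction A rule: infinite_finite_induct) (simp_all add: subst_poly_add)

lemma subst_poly_prod: "subst_poly \<sigma> (prod h A) = (\<Prod>i\<in>A. subst_poly \<sigma> (h i))"
  using subst_poly_Const[of \<sigma> 1]
  by (induction A rule: infinite_finite_induct) (simp_all add: subst_poly_mult)

lemma subst_poly_power: "subst_poly \<sigma> (f ^ k) = subst_poly \<sigma> f ^ k"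
  using subst_poly_prod[of \<sigma> "\<lambda>_. f" "{..<k}"] by simp

lemma subst_poly_subst_poly:
  "subst_poly \<sigma> (subst_poly \<tau> f) = subst_poly (\<lambda>i. subst_poly \<sigma> (\<tau> i)) f"
  unfolding subst_poly_def[of \<tau>] subst_poly_def[of "\<lambda>i. subst_poly \<sigma> (\<tau> i)"]
  by (simp add: subst_poly_sum subst_poly_mult subst_poly_prod subst_poly_power)

lemma subst_poly_cong:
  assumes "f \<in> poly_ring n" "\<And>i. i < n \<Longrightarrow> \<sigma> i = \<tau> i"
  shows "subst_poly \<sigma> f = subst_poly \<tau> f"
  unfolding subst_poly_def
proof (intro sum.cong arg_cong[where f = "\<lambda>t. _ * t"] prod.cong refl)
  fix m i assume "m \<in> Poly_Mapping.keys f" "i \<in> Poly_Mapping.keys m"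
  then have "i < n" using assms(1) by (auto simp: poly_ring_def)
  then show "\<sigma> i ^ Poly_Mapping.lookup m i = \<tau> i ^ Poly_Mapping.lookup m i"
    using assms(2) by simp
qed

lemma prod_Var_power:
  "(\<Prod>i\<in>Poly_Mapping.keys m. Var i ^ Poly_Mapping.lookup m i) = Poly_Mapping.single m 1"
proof -
  have power: "Var i ^ k = Poly_Mapping.single (Poly_Mapping.single i k) 1" for i k
    by (induction k) (simp_all add: Var_def mult_single flip: single_add)
  have prod: "(\<Prod>i\<in>A. Poly_Mapping.single (h i) 1) = Poly_Mapping.single (sum h A) (1::complex)"
    for h :: "nat \<Rightarrow> nat \<Rightarrow>\<^sub>0 nat" and A
    by (induction A rule: infinite_finite_induct) (simp_all add: mult_single)
  show ?thesis by (simp only: power prod flip: poly_mapping_sum_singles)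
qed

text \<open>Monomials are eigenvectors of a diagonal substitution. No two of them interfere, so the
  coefficients of the result can be read off.\<close>

lemma subst_poly_scale:
  "subst_poly (\<lambda>i. Const (t i) * Var i) f = (\<Sum>m\<in>Poly_Mapping.keys f. Poly_Mapping.single m
    (Poly_Mapping.lookup f m * (\<Prod>i\<in>Poly_Mapping.keys m. t i ^ Poly_Mapping.lookup m i)))"
  unfolding subst_poly_def
proof (rule sum.cong[OF refl])
  fix m
  let ?t = "\<Prod>i\<in>Poly_Mapping.keys m. t i ^ Poly_Mapping.lookup m i"
  have "(\<Prod>i\<in>Poly_Mapping.keys m. (Const (t i) * Var i) ^ Poly_Mapping.lookup m i)
      = Const ?t * Poly_Mapping.single m 1"
    by (simp add: power_mult_distrib prod.distrib Const_prod Const_power prod_Var_power)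
  then show "Const (Poly_Mapping.lookup f m) *
      (\<Prod>i\<in>Poly_Mapping.keys m. (Const (t i) * Var i) ^ Poly_Mapping.lookup m i) =
      Poly_Mapping.single m (Poly_Mapping.lookup f m * ?t)"
    by (simp add: Const_def mult_single)
qed

lemma subst_poly_Var_id: "subst_poly Var f = f"
  using subst_poly_scale[of "\<lambda>_. 1" f] by (simp flip: poly_mapping_sum_singles)

lemma lookup_subst_poly_scale:
  "Poly_Mapping.lookup (subst_poly (\<lambda>i. Const (t i) * Var i) f) m =
    Poly_Mapping.lookup f m * (\<Prod>i\<in>Poly_Mapping.keys m. t i ^ Poly_Mapping.lookup m i)"
proof -
  have "Poly_Mapping.lookup (subst_poly (\<lambda>i. Const (t i) * Var i) f) m =
      (\<Sum>l\<in>Poly_Mapping.keys f. if l = m then Poly_Mapping.lookup f m *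
        (\<Prod>i\<in>Poly_Mapping.keys m. t i ^ Poly_Mapping.lookup m i) else 0)"
    unfolding subst_poly_scale lookup_sum by (intro sum.cong) (auto simp: lookup_single)
  then show ?thesis by (auto simp: in_keys_iff)
qed

lemma subst_poly_dft:
  "subst_poly \<sigma> (dft n (Const w) x k) = dft n (Const w) (\<lambda>j. subst_poly \<sigma> (x j)) k"
  by (simp add: dft_def subst_poly_sum subst_poly_mult flip: Const_power)

lemma subst_poly_inv_dft:
  "subst_poly \<sigma> (inv_dft n (Const v) (Const c) y j) =
    inv_dft n (Const v) (Const c) (\<lambda>k. subst_poly \<sigma> (y k)) j"
  by (simp add: inv_dft_def subst_poly_sum subst_poly_mult flip: Const_power)

lemma subst_poly_cyclic_conv:
  "subst_poly \<sigma> (cyclic_conv n (\<lambda>j. Const (a j)) x r) =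
    cyclic_conv n (\<lambda>j. Const (a j)) (\<lambda>s. subst_poly \<sigma> (x s)) r"
  by (simp add: cyclic_conv_def subst_poly_sum subst_poly_mult)

section \<open>The polynomial ring and its subalgebras\<close>

lemma subalgebra_sum:
  assumes "is_subalgebra S" "\<And>i. i \<in> A \<Longrightarrow> h i \<in> S"
  shows "sum h A \<in> S"
proof -
  have "Const 0 \<in> S" using assms(1) unfolding is_subalgebra_def by blast
  with assms(2) show ?thesis
    by (induction A rule: infinite_finite_induct) (use assms(1) in \<open>auto simp: is_subalgebra_def\<close>)
qed

lemma subalgebra_prod:
  assumes "is_subalgebra S" "\<And>i. i \<in> A \<Longrightarrow> h i \<in> S"
  shows "prod h A \<in> S"
proof -
  have "Const 1 \<in> S" using assms(1) unfolding is_subalgebra_def by blast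
  with assms(2) show ?thesis
    by (induction A rule: infinite_finite_induct) (use assms(1) in \<open>auto simp: is_subalgebra_def\<close>)
qed

lemma subalgebra_power: "is_subalgebra S \<Longrightarrow> f \<in> S \<Longrightarrow> f ^ k \<in> S"
  using subalgebra_prod[of S "{..<k}" "\<lambda>_. f"] by simp

lemma is_subalgebra_poly_ring: "is_subalgebra (poly_ring n)"
  unfolding is_subalgebra_def
proof (intro conjI ballI)
  show "range Const \<subseteq> poly_ring n" by (auto simp: poly_ring_def Const_def split: if_splits)
  fix f g assume fg: "f \<in> poly_ring n" "g \<in> poly_ring n"
  then show "f + g \<in> poly_ring n"
    using keys_add[of f g] by (force simp: poly_ring_def)
  show "f * g \<in> poly_ring n"
    unfolding poly_ring_def
  proof (intro CollectI ballI)
    fix m assume "m \<in> Poly_Mapping.keys (f * g)"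
    then obtain a b where "m = a + b" "a \<in> Poly_Mapping.keys f" "b \<in> Poly_Mapping.keys g"
      using keys_mult[of f g] by blast
    then show "Poly_Mapping.keys m \<subseteq> {..<n}"
      using fg keys_add[of a b] unfolding poly_ring_def by blast
  qed
qed

lemma Const_in_poly_ring: "Const c \<in> poly_ring n"
  using is_subalgebra_poly_ring[of n] by (auto simp: is_subalgebra_def)

lemma mult_in_poly_ring: "f \<in> poly_ring n \<Longrightarrow> g \<in> poly_ring n \<Longrightarrow> f * g \<in> poly_ring n"
  using is_subalgebra_poly_ring[of n] by (auto simp: is_subalgebra_def)

lemma Var_in_poly_ring: "i < n \<Longrightarrow> Var i \<in> poly_ring n"
  by (auto simp: poly_ring_def Var_def)

lemma subst_poly_in_poly_ring:
  assumes "f \<in> poly_ring n" "\<And>i. i < n \<Longrightarrow> \<sigma> i \<in> poly_ring k"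
  shows "subst_poly \<sigma> f \<in> poly_ring k"
  unfolding subst_poly_def
proof (intro subalgebra_sum subalgebra_prod subalgebra_power mult_in_poly_ring
    Const_in_poly_ring is_subalgebra_poly_ring)
  fix m i assume "m \<in> Poly_Mapping.keys f" "i \<in> Poly_Mapping.keys m"
  then have "i < n" using assms(1) by (auto simp: poly_ring_def)
  then show "\<sigma> i \<in> poly_ring k" by (rule assms(2))
qed

section \<open>The derivation\<close>

lemma partial_deriv_single:
  "partial_deriv i (Poly_Mapping.single m c) =
    Poly_Mapping.single (m - Poly_Mapping.single i 1) (of_nat (Poly_Mapping.lookup m i) * c)"
  by (cases "c = 0") (simp_all add: partial_deriv_def)

lemma partial_deriv_Const: "partial_deriv i (Const c) = 0"
  by (simp add: Const_def partial_deriv_single)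

lemma partial_deriv_Var: "partial_deriv i (Var j) = (if i = j then 1 else 0)"
  by (simp add: Var_def partial_deriv_single lookup_single)

lemma partial_deriv_add: "partial_deriv i (f + g) = partial_deriv i f + partial_deriv i g"
  unfolding partial_deriv_def
  by (rule setsum_keys_plus_distrib) (simp_all add: distrib_left flip: single_add)

text \<open>On monomials the only obstacle to the usual computation is truncated subtraction of exponents,
  and where it truncates, the coefficient is zero.\<close>

lemma partial_deriv_mult:
  "partial_deriv i (f * g) = partial_deriv i f * g + f * partial_deriv i g"
proof (rule biadditive_eqI[of "\<lambda>f g. partial_deriv i (f * g)"
      "\<lambda>f g. partial_deriv i f * g + f * partial_deriv i g"])
  fix m m' :: "nat \<Rightarrow>\<^sub>0 nat" and c c' :: complex
  let ?e = "Poly_Mapping.single i (1::nat)"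
  have shift: "Poly_Mapping.single (a - ?e + b) (of_nat (Poly_Mapping.lookup a i) * z) =
      Poly_Mapping.single (a + b - ?e) (of_nat (Poly_Mapping.lookup a i) * z)"
    for a b :: "nat \<Rightarrow>\<^sub>0 nat" and z :: complex
  proof (cases "Poly_Mapping.lookup a i = 0")
    case False
    then have "a - ?e + b = a + b - ?e"
      by (intro poly_mapping_eqI) (auto simp: lookup_add lookup_minus lookup_single when_def)
    then show ?thesis by simp
  qed simp
  show "partial_deriv i (Poly_Mapping.single m c * Poly_Mapping.single m' c') =
      partial_deriv i (Poly_Mapping.single m c) * Poly_Mapping.single m' c' +
      Poly_Mapping.single m c * partial_deriv i (Poly_Mapping.single m' c')"
    using shift[of m m' "c * c'"] shift[of m' m "c * c'"]
    by (simp add: mult_single partial_deriv_single lookup_add ac_simps distrib_left distrib_right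
        single_add)
qed (simp_all add: partial_deriv_add algebra_simps)

lemma D_op_Const: "D_op n (Const c) = 0"
  by (simp add: D_op_def partial_deriv_Const)

lemma D_op_add: "D_op n (f + g) = D_op n f + D_op n g"
  by (simp add: D_op_def partial_deriv_add distrib_left sum.distrib)

lemma D_op_mult: "D_op n (f * g) = D_op n f * g + f * D_op n g"
  unfolding D_op_def partial_deriv_mult
  by (simp add: algebra_simps sum.distrib sum_distrib_left sum_distrib_right)

lemma D_op_Var:
  assumes "j < n"
  shows "D_op n (Var j) = Var ((j + n - 1) mod n)"
proof -
  have "D_op n (Var j) = (\<Sum>i<n. if i = j then Var (if j = 0 then n - 1 else j - 1) else 0)"
    unfolding D_op_def partial_deriv_Var by (intro sum.cong) auto
  also have "\<dots> = Var (if j = 0 then n - 1 else j - 1)"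
    using assms by simp
  also have "(if j = 0 then n - 1 else j - 1) = (j + n - 1) mod n"
    using assms by (cases j) auto
  finally show ?thesis .
qed

lemma D_op_sum: "D_op n (sum h A) = (\<Sum>i\<in>A. D_op n (h i))"
  using D_op_Const[of n 0]
  by (induction A rule: infinite_finite_induct) (simp_all add: D_op_add)

lemma D_op_prod_eigenvectors:
  assumes "\<And>k. k \<in> A \<Longrightarrow> D_op n (y k) = e k * y k"
  shows "D_op n (prod y A) = sum e A * prod y A"
  using D_op_Const[of n 1] assms
  by (induction A rule: infinite_finite_induct) (simp_all add: D_op_mult algebra_simps)

text \<open>\<open>D\<close> replaces \<open>x\<^sub>j\<close> by its cyclic predecessor, so reindexing the sum in \<open>y\<^sub>k\<close> contributes one
  extra factor \<open>w^k\<close>.\<close>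

lemma D_op_dft_Var:
  assumes "principal_root n w v c" "2 \<le> n"
  shows "D_op n (dft n (Const w) Var k) = Const w ^ k * dft n (Const w) Var k"
proof -
  interpret principal_root n "Const w" "Const v" "Const c"
    by (rule principal_root_Const) fact
  have "D_op n (dft n (Const w) Var k) = (\<Sum>j<n. Const w ^ (j * k) * Var ((j + n - 1) mod n))"
    by (simp add: dft_def D_op_sum D_op_mult D_op_Const D_op_Var flip: Const_power)
  also have "\<dots> = (\<Sum>j<n. Const w ^ k *
      (Const w ^ ((j + n - 1) mod n * k) * Var ((j + n - 1) mod n)))"
  proof (rule sum.cong[OF refl])
    fix j assume "j \<in> {..<n}"
    then have "((j + n - 1) mod n + 1) mod n = j"
      using assms(2) by (intro sub_mod_add_cancel) auto
    then have "Const w ^ (j * k) = Const w ^ (((j + n - 1) mod n + 1) * k)"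
      by (intro power_eq_if_mod_eq) (metis mod_mult_left_eq)
    then show "Const w ^ (j * k) * Var ((j + n - 1) mod n) = Const w ^ k *
        (Const w ^ ((j + n - 1) mod n * k) * Var ((j + n - 1) mod n))"
      by (simp add: power_add algebra_simps)
  qed
  also have "\<dots> = Const w ^ k * dft n (Const w) Var k"
    unfolding dft_def sum_distrib_left
    using sum_cyclic_shift[of 1 n "\<lambda>d. Const w ^ k * (Const w ^ (d * k) * Var d)"] assms(2) by simp
  finally show ?thesis .
qed

lemma is_subalgebra_D_constants: "is_subalgebra (D_constants n)"
  using is_subalgebra_poly_ring[of n] unfolding is_subalgebra_def D_constants_def
  by (auto simp: D_op_Const D_op_add D_op_mult)

section \<open>Invariants of the unimodular circulant matrices\<close>

lemma act_circulant_mat: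
  assumes "f \<in> poly_ring n"
  shows "act n (circulant_mat n a) f = subst_poly (cyclic_conv n (\<lambda>j. Const (a j)) Var) f"
  unfolding act_def
  by (rule subst_poly_cong[OF assms])
    (simp add: circulant_mat_def scalar_prod_def cyclic_conv_def atLeast0LessThan)

lemma is_subalgebra_invariants: "is_subalgebra (invariants n H)"
  using is_subalgebra_poly_ring[of n] unfolding is_subalgebra_def invariants_def act_def
  by (auto simp: subst_poly_add subst_poly_mult)

lemma dft_Var_in_poly_ring: "dft n (Const w) Var k \<in> poly_ring n"
  unfolding dft_def
  by (intro subalgebra_sum is_subalgebra_poly_ring mult_in_poly_ring)
    (auto simp: Const_in_poly_ring Var_in_poly_ring simp flip: Const_power)

lemma inv_dft_Var_in_poly_ring: "inv_dft n (Const v) (Const c) Var j \<in> poly_ring n"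
  unfolding inv_dft_def
  by (intro subalgebra_sum is_subalgebra_poly_ring mult_in_poly_ring)
    (auto simp: Const_in_poly_ring Var_in_poly_ring simp flip: Const_power)

lemma circulant_det_eq_prod_dft:
  assumes "principal_root n w v c"
  shows "circulant_det n = (\<Prod>k<n. dft n (Const w) Var k)"
  unfolding circulant_det_def
  by (rule principal_root.det_circulant_mat[OF principal_root_Const[OF assms]])

lemma circulant_det_in_poly_ring:
  fixes w v c :: complex
  assumes "principal_root n w v c"
  shows "circulant_det n \<in> poly_ring n"
  unfolding circulant_det_eq_prod_dft[OF assms]
  by (intro subalgebra_prod is_subalgebra_poly_ring dft_Var_in_poly_ring)

lemma circulant_det_invariant:
  fixes w v c :: complex
  assumes "principal_root n w v c"
  shows "circulant_det n \<in> invariants n (SL_circulant n)"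
  unfolding invariants_def
proof (intro CollectI conjI ballI circulant_det_in_poly_ring[OF assms])
  interpret C: principal_root n w v c by fact
  interpret P: principal_root n "Const w" "Const v" "Const c"
    by (rule principal_root_Const) fact
  fix A assume "A \<in> SL_circulant n"
  then obtain a where A: "A = circulant_mat n a" and det: "det A = 1"
    by (auto simp: SL_circulant_def SL_def)
  have "act n A (circulant_det n) =
      (\<Prod>k<n. dft n (Const w) (cyclic_conv n (\<lambda>j. Const (a j)) Var) k)"
    by (simp add: A act_circulant_mat circulant_det_in_poly_ring[OF assms])
      (simp add: circulant_det_eq_prod_dft[OF assms] subst_poly_prod subst_poly_dft)
  also have "\<dots> = (\<Prod>k<n. Const (dft n w a k) * dft n (Const w) Var k)"
    by (simp add: P.dft_cyclic_conv dft_Const)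
  also have "\<dots> = Const (det A) * circulant_det n"
    by (simp add: A C.det_circulant_mat prod.distrib Const_prod circulant_det_eq_prod_dft[OF assms])
  finally show "act n A (circulant_det n) = circulant_det n" by (simp add: det)
qed

lemma circulant_det_D_constant:
  fixes w v c :: complex
  assumes "principal_root n w v c" "2 \<le> n"
  shows "circulant_det n \<in> D_constants n"
proof -
  interpret P: principal_root n "Const w" "Const v" "Const c"
    by (rule principal_root_Const) fact
  have "D_op n (circulant_det n) = (\<Sum>k<n. Const w ^ k) * circulant_det n"
    unfolding circulant_det_eq_prod_dft[OF assms(1)]
    by (rule D_op_prod_eigenvectors) (rule D_op_dft_Var[OF assms])
  then show ?thesis
    using P.sum_powers[of 1] assms circulant_det_in_poly_ring[OF assms(1)]
    by (simp add: D_constants_def)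
qed

text \<open>If some monomial had different exponents at \<open>i\<close> and \<open>j\<close>, the torus element with entries \<open>2\<close>
  and \<open>1/2\<close> in these two places and \<open>1\<close> elsewhere would change its coefficient.\<close>

lemma torus_invariant_exponents_equal:
  assumes inv: "\<And>t. (\<Prod>k<n. t k) = 1 \<Longrightarrow> subst_poly (\<lambda>k. Const (t k) * Var k) g = g"
    and g: "g \<in> poly_ring n" and m: "m \<in> Poly_Mapping.keys g" and ij: "i < n" "j < n"
  shows "Poly_Mapping.lookup m i = Poly_Mapping.lookup m j"
proof (cases "i = j")
  case False
  define t :: "nat \<Rightarrow> complex" where "t = (\<lambda>_. 1)(i := 2, j := 1 / 2)"
  have split: "(\<Prod>k<n. t k ^ e k) = 2 ^ e i * (1 / 2) ^ e j" for e :: "nat \<Rightarrow> nat"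
  proof -
    have "(\<Prod>k<n. t k ^ e k) = (\<Prod>k\<in>{i, j}. t k ^ e k)"
      using ij by (intro prod.mono_neutral_right) (auto simp: t_def)
    then show ?thesis using False by (simp add: t_def)
  qed
  have "(\<Prod>k<n. t k) = 1" using split[of "\<lambda>_. 1"] by simp
  then have "subst_poly (\<lambda>k. Const (t k) * Var k) g = g" by (rule inv)
  then have "Poly_Mapping.lookup g m = Poly_Mapping.lookup g m *
      (\<Prod>k\<in>Poly_Mapping.keys m. t k ^ Poly_Mapping.lookup m k)"
    using lookup_subst_poly_scale[of t g m] by simp
  also have "(\<Prod>k\<in>Poly_Mapping.keys m. t k ^ Poly_Mapping.lookup m k) =
      (\<Prod>k<n. t k ^ Poly_Mapping.lookup m k)"
    using g m by (intro prod.mono_neutral_left) (auto simp: poly_ring_def in_keys_iff)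
  finally have "(2::complex) ^ Poly_Mapping.lookup m i * (1 / 2) ^ Poly_Mapping.lookup m j = 1"
    using m unfolding split by (simp add: in_keys_iff)
  then have "(2::complex) ^ Poly_Mapping.lookup m i = 2 ^ Poly_Mapping.lookup m j"
    by (simp add: power_one_over field_simps)
  then have "of_nat (2 ^ Poly_Mapping.lookup m i) = (of_nat (2 ^ Poly_Mapping.lookup m j) :: complex)"
    by simp
  then show ?thesis unfolding of_nat_eq_iff by simp
qed simp

text \<open>Rewrite \<open>f\<close> as a polynomial \<open>g\<close> in the Fourier coordinates. Invariance of \<open>f\<close> under the
  circulant matrices becomes invariance of \<open>g\<close> under the torus, so every monomial of \<open>g\<close> is a power
  of the product of the coordinates, which is the circulant determinant.\<close>

lemma invariant_in_subalgebra:
  fixes w v c :: complex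
  assumes root: "principal_root n w v c"
    and f: "f \<in> invariants n (SL_circulant n)"
    and S: "is_subalgebra S" "circulant_det n \<in> S"
  shows "f \<in> S"
proof -
  interpret C: principal_root n w v c by fact
  interpret P: principal_root n "Const w" "Const v" "Const c"
    by (rule principal_root_Const) fact
  have f_ring: "f \<in> poly_ring n" using f by (simp add: invariants_def)
  define y where "y = dft n (Const w) Var"
  define x where "x = inv_dft n (Const v) (Const c) Var"
  define g where "g = subst_poly x f"
  have g_ring: "g \<in> poly_ring n"
    unfolding g_def x_def by (rule subst_poly_in_poly_ring[OF f_ring inv_dft_Var_in_poly_ring])
  \<comment> \<open>\<open>x\<close> and \<open>y\<close> are mutually inverse changes of coordinates\<close>
  have "subst_poly y g = subst_poly Var f"
    unfolding g_def subst_poly_subst_poly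
    by (rule subst_poly_cong[OF f_ring]) (simp add: x_def y_def subst_poly_inv_dft P.inv_dft_dft)
  then have f_eq: "f = subst_poly y g" by (simp add: subst_poly_Var_id)
  have g_inv: "subst_poly (\<lambda>k. Const (t k) * Var k) g = g" if t: "(\<Prod>k<n. t k) = 1" for t
  proof -
    \<comment> \<open>the circulant matrix with the prescribed eigenvalues \<open>t\<close>\<close>
    define a where "a = inv_dft n v c t"
    have dft_a: "dft n w a k = t k" if "k < n" for k
      unfolding a_def by (rule C.dft_inv_dft[OF that])
    then have "det (circulant_mat n a) = 1"
      by (simp add: C.det_circulant_mat t)
    then have "circulant_mat n a \<in> SL_circulant n"
      by (auto simp: SL_circulant_def SL_def circulant_mat_def)
    then have "subst_poly (cyclic_conv n (\<lambda>j. Const (a j)) Var) f = f"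
      using f by (simp add: invariants_def flip: act_circulant_mat[OF f_ring])
    then have "g = subst_poly (\<lambda>r. cyclic_conv n (\<lambda>j. Const (a j)) x r) f"
      using subst_poly_subst_poly[of x "cyclic_conv n (\<lambda>j. Const (a j)) Var" f]
      by (simp add: g_def subst_poly_cyclic_conv)
    also have "\<dots> = subst_poly (\<lambda>r. subst_poly (\<lambda>k. Const (t k) * Var k) (x r)) f"
    proof (rule subst_poly_cong[OF f_ring])
      fix r assume "r < n"
      then have "cyclic_conv n (\<lambda>j. Const (a j)) x r =
          inv_dft n (Const v) (Const c) (\<lambda>k. Const (dft n w a k) * Var k) r"
        by (simp add: x_def P.cyclic_conv_inv_dft dft_Const)
      also have "\<dots> = subst_poly (\<lambda>k. Const (t k) * Var k) (x r)"
        unfolding x_def subst_poly_inv_dft by (simp add: inv_dft_def dft_a)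
      finally show "cyclic_conv n (\<lambda>j. Const (a j)) x r =
          subst_poly (\<lambda>k. Const (t k) * Var k) (x r)" .
    qed
    also have "\<dots> = subst_poly (\<lambda>k. Const (t k) * Var k) g"
      by (simp add: g_def subst_poly_subst_poly)
    finally show ?thesis ..
  qed
  have exponents: "Poly_Mapping.lookup m i = Poly_Mapping.lookup m j"
    if "m \<in> Poly_Mapping.keys g" "i < n" "j < n" for m i j
    by (rule torus_invariant_exponents_equal[OF _ g_ring that]) (rule g_inv)
  \<comment> \<open>all exponents agree, and the one at index \<open>0\<close> represents them\<close>
  have "(\<Prod>i\<in>Poly_Mapping.keys m. y i ^ Poly_Mapping.lookup m i) =
      circulant_det n ^ Poly_Mapping.lookup m 0" if m: "m \<in> Poly_Mapping.keys g" for m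
  proof -
    have "(\<Prod>i\<in>Poly_Mapping.keys m. y i ^ Poly_Mapping.lookup m i) =
        (\<Prod>i<n. y i ^ Poly_Mapping.lookup m i)"
      using g_ring m by (intro prod.mono_neutral_left) (auto simp: poly_ring_def in_keys_iff)
    also have "\<dots> = (\<Prod>i<n. y i ^ Poly_Mapping.lookup m 0)"
    proof (rule prod.cong[OF refl])
      fix i assume "i \<in> {..<n}"
      then have "Poly_Mapping.lookup m i = Poly_Mapping.lookup m 0"
        using C.n_pos by (intro exponents[OF m]) auto
      then show "y i ^ Poly_Mapping.lookup m i = y i ^ Poly_Mapping.lookup m 0"
        by (rule arg_cong)
    qed
    also have "\<dots> = circulant_det n ^ Poly_Mapping.lookup m 0"
      by (simp add: circulant_det_eq_prod_dft[OF root] y_def prod_power_distrib)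
    finally show ?thesis .
  qed
  then have "f = (\<Sum>m\<in>Poly_Mapping.keys g.
      Const (Poly_Mapping.lookup g m) * circulant_det n ^ Poly_Mapping.lookup m 0)"
    unfolding f_eq subst_poly_def by simp
  also have "\<dots> \<in> S"
  proof (rule subalgebra_sum[OF S(1)])
    fix m
    have "Const (Poly_Mapping.lookup g m) \<in> S"
      using S(1) by (auto simp: is_subalgebra_def)
    then show "Const (Poly_Mapping.lookup g m) * circulant_det n ^ Poly_Mapping.lookup m 0 \<in> S"
      using subalgebra_power[OF S] S(1) by (auto simp: is_subalgebra_def)
  qed
  finally show ?thesis .
qed

theorem theorem5:
  fixes n :: nat
  assumes "n \<ge> 2"
  shows "invariants n (SL_circulant n) = generated_subalgebra n {circulant_det n} \<and>
         generated_subalgebra n {circulant_det n} \<subseteq> D_constants n"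
proof -
  have root: "principal_root n (cis (2 * pi / n)) (cis (- 2 * pi / n)) (1 / of_nat n)"
    using assms by (intro principal_root_cis) auto
  have least: "generated_subalgebra n {circulant_det n} \<subseteq> S"
    if "S \<subseteq> poly_ring n" "is_subalgebra S" "circulant_det n \<in> S" for S
    unfolding generated_subalgebra_def using that by (intro hull_minimal) auto
  have "invariants n (SL_circulant n) \<subseteq> generated_subalgebra n {circulant_det n}"
    using invariant_in_subalgebra[OF root] unfolding generated_subalgebra_def hull_def by auto
  moreover have "generated_subalgebra n {circulant_det n} \<subseteq> invariants n (SL_circulant n)"
    by (rule least[OF _ is_subalgebra_invariants circulant_det_invariant[OF root]])
      (auto simp: invariants_def)
  moreover have "generated_subalgebra n {circulant_det n} \<subseteq> D_constants n"
    by (rule least[OF _ is_subalgebra_D_constants circulant_det_D_constant[OF root assms]])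
      (auto simp: D_constants_def)
  ultimately show ?thesis by blast
qed

end
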